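(* Let $n$ be an integer and let $s,k$ be relatively prime odd integers with $1<s<k<\sqrt{n/2}$. Let $L$ be a $\mathbb{Z}$-lattice with $\min(L)\ge 2$ such that there are representations $\phi_k:A_{n,k}\to L$ and $\phi_s:A_{n,s}\to L$. Then $R_L(\phi_k(A_{n-1}))$ and $R_L(\phi_s(A_{n-1}))$ are distinct, hence mutually orthogonal, indecomposable components of $R_L$.
   Context: All $\mathbb{Z}$-lattices are positive definite with integral Gram matrix; a representation $\phi:M\to L$ is a linear map with $Q(\phi(x))=Q(x)$; $\min(L)=\min\{Q(x):0\ne x\in L\}$. $I_n=\mathbb{Z}e_1+\dots+\mathbb{Z}e_n$ with $B(e_i,e_j)=\delta_{ij}$. For $1<k\le n-1$, $A_{n,k}=\mathbb{Z}(-e_1+e_2)+\dots+\mathbb{Z}(-e_{n-1}+e_n)+\mathbb{Z}(-(e_{n-k+1}+\dots+e_n))\subset I_n$, and $A_{n-1}$ denotes the common sublattice $\mathbb{Z}(-e_1+e_2)+\dots+\mathbb{Z}(-e_{n-1}+e_n)$ of all $A_{n,k}$. For a lattice $L$, $R_L$ is the sublattice generated by all vectors of norm $1$ or $2$; it is an orthogonal sum of indecomposable root lattices, and for an indecomposable root sublattice $\ell$ of $L$, $R_L(\ell)$ denotes the indecomposable component of $R_L$ containing $\ell$. *)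

theory Defs
  imports "HOL-Analysis.Analysis"
begin

text \<open>
  A positive definite \<open>\<int>\<close>-lattice \<open>L\<close> is realised inside the Euclidean space \<open>L \<otimes> \<real>\<close>
  (or any larger one), so that the symmetric bilinear form \<open>B(x, y)\<close> is the inner product
  \<open>x \<bullet> y\<close> and \<open>Q(x) = x \<bullet> x\<close>.
\<close>

definition zspan :: "'a::real_vector set \<Rightarrow> 'a set" where
  "zspan S = {\<Sum>x\<in>T. of_int (c x) *\<^sub>R x | T (c :: 'a \<Rightarrow> int). finite T \<and> T \<subseteq> S}"

definition zlattice :: "'a::real_inner set \<Rightarrow> bool" where
  "zlattice L \<longleftrightarrow>
     (\<exists>b. finite b \<and> independent b \<and> L = zspan b \<and> (\<forall>x\<in>b. \<forall>y\<in>b. x \<bullet> y \<in> \<int>))"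

definition representation ::
  "'b::real_inner set \<Rightarrow> 'a::real_inner set \<Rightarrow> ('b \<Rightarrow> 'a) \<Rightarrow> bool" where
  "representation M L \<phi> \<longleftrightarrow>
     (\<forall>x\<in>M. \<phi> x \<in> L) \<and>
     (\<forall>x\<in>M. \<forall>y\<in>M. \<forall>a b :: int.
        \<phi> (of_int a *\<^sub>R x + of_int b *\<^sub>R y) = of_int a *\<^sub>R \<phi> x + of_int b *\<^sub>R \<phi> y) \<and>
     (\<forall>x\<in>M. \<phi> x \<bullet> \<phi> x = x \<bullet> x)"

text \<open>The minimum exists for every nonzero lattice; the value for \<open>L = {0}\<close> is unspecified.\<close>

definition lattice_min :: "'a::real_inner set \<Rightarrow> real" where
  "lattice_min L = (LEAST q. \<exists>x\<in>L. x \<noteq> 0 \<and> q = x \<bullet> x)"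

text \<open>The family \<open>e 1, \<dots>, e n\<close> is the standard basis of \<open>I\<^sub>n = \<int>e\<^sub>1 + \<dots> + \<int>e\<^sub>n\<close>; the values
  of \<open>e\<close> at other indices are irrelevant.\<close>

definition orthonormal_family :: "nat \<Rightarrow> (nat \<Rightarrow> 'b::real_inner) \<Rightarrow> bool" where
  "orthonormal_family n e \<longleftrightarrow>
     (\<forall>i\<in>{1..n}. \<forall>j\<in>{1..n}. e i \<bullet> e j = (if i = j then 1 else 0))"

lemma orthonormal_family_exists:
  assumes "n \<le> DIM('b::euclidean_space)"
  shows "\<exists>e :: nat \<Rightarrow> 'b. orthonormal_family n e"
proof -
  have "card {1..n} \<le> card (Basis :: 'b set)" using assms by simp
  then obtain e :: "nat \<Rightarrow> 'b" where "inj_on e {1..n}" "e ` {1..n} \<subseteq> Basis"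
    using card_le_inj[of "{1..n}" "Basis :: 'b set"] by auto
  then have "orthonormal_family n e"
    unfolding orthonormal_family_def
    by (metis (no_types, lifting) imageI in_mono inj_on_eq_iff inner_Basis)
  then show ?thesis by blast
qed

text \<open>\<open>A_root n e\<close> is \<open>A\<close> with index \<open>n - 1\<close>, of rank \<open>n - 1\<close>; it sits in every \<open>A_lat n k e\<close>.\<close>

definition A_root :: "nat \<Rightarrow> (nat \<Rightarrow> 'b::real_inner) \<Rightarrow> 'b set" where
  "A_root n e = zspan {- e i + e (i + 1) | i. i \<in> {1..<n}}"

definition A_lat :: "nat \<Rightarrow> nat \<Rightarrow> (nat \<Rightarrow> 'b::real_inner) \<Rightarrow> 'b set" where
  "A_lat n k e =
     zspan ({- e i + e (i + 1) | i. i \<in> {1..<n}} \<union> {- (\<Sum>i = n - k + 1..n. e i)})"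

definition orthogonal_lattices :: "'a::real_inner set \<Rightarrow> 'a set \<Rightarrow> bool" where
  "orthogonal_lattices M N \<longleftrightarrow> (\<forall>x\<in>M. \<forall>y\<in>N. x \<bullet> y = 0)"

definition indecomposable :: "'a::real_inner set \<Rightarrow> bool" where
  "indecomposable M \<longleftrightarrow> zlattice M \<and> M \<noteq> {0} \<and>
     \<not> (\<exists>M1 M2. zlattice M1 \<and> zlattice M2 \<and> M1 \<noteq> {0} \<and> M2 \<noteq> {0} \<and>
           orthogonal_lattices M1 M2 \<and> M = zspan (M1 \<union> M2))"

definition indecomposable_splitting :: "'a::real_inner set \<Rightarrow> 'a set set \<Rightarrow> bool" where
  "indecomposable_splitting M C \<longleftrightarrow>
     finite C \<and> (\<forall>K\<in>C. indecomposable K) \<and> pairwise orthogonal_lattices C \<and> M = zspan (\<Union>C)"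

definition indecomposable_component :: "'a::real_inner set \<Rightarrow> 'a set \<Rightarrow> bool" where
  "indecomposable_component M K \<longleftrightarrow> (\<exists>C. indecomposable_splitting M C \<and> K \<in> C)"

definition root_sublattice :: "'a::real_inner set \<Rightarrow> 'a set" where
  "root_sublattice L = zspan {x \<in> L. x \<bullet> x = 1 \<or> x \<bullet> x = 2}"

text \<open>The component \<open>R\<^sub>L(N)\<close>. It is well defined for an indecomposable root sublattice \<open>N\<close> of \<open>L\<close>,
  because the splitting of a positive definite lattice into indecomposable sublattices is unique.\<close>

definition root_component :: "'a::real_inner set \<Rightarrow> 'a set \<Rightarrow> 'a set" where
  "root_component L N =
     (THE K. indecomposable_component (root_sublattice L) K \<and> N \<subseteq> K)"

end

theory Submission imports Defs begin

text \<open>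
  Although \<open>e\<^sub>i \<notin> A\<^sub>n\<^sub>,\<^sub>k\<close>, the multiples \<open>k e\<^sub>i\<close> are in it, so \<open>\<phi>\<^sub>k\<close> extends to \<open>I\<^sub>n\<close> over \<open>\<rat>\<close>: it gives
  orthonormal vectors \<open>f\<^sub>i\<close> with \<open>f\<^sub>i - f\<^sub>j \<in> L\<close> and \<open>k f\<^sub>i \<in> L\<close>. Let \<open>H\<close> be the set of all unit vectors
  congruent to \<open>f\<^sub>1\<close> modulo \<open>L\<close>. As \<open>k\<close> is odd and \<open>L\<close> has no vector of norm \<open>1\<close>, \<open>H\<close> is orthonormal.
  If \<open>\<alpha> \<in> L\<close> has norm \<open>2\<close>, then the products \<open>\<alpha> \<bullet> f\<^sub>i\<close> lie in \<open>\<int>/k\<close>, and as \<open>n / k\<^sup>2 > 2\<close> one of them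
  vanishes. Hence \<open>\<alpha> \<bullet> h\<close> is an integer for \<open>h \<in> H\<close>, which forces \<open>\<alpha>\<close> to be orthogonal to \<open>H\<close> or
  a difference of two elements of \<open>H\<close>. So these differences span the component \<open>R\<close> of the root
  lattice that contains \<open>\<phi>\<^sub>k(A\<^sub>n\<^sub>-\<^sub>1)\<close>, and no classification of root systems is needed.

  If the vectors \<open>g\<^sub>j\<close> obtained from \<open>\<phi>\<^sub>s\<close> led to the same component, the roots \<open>g\<^sub>1 - g\<^sub>j\<close> would be
  differences of elements of \<open>H\<close>, so \<open>g\<^sub>j = x \<plusminus> b\<^sub>j\<close> with \<open>b\<^sub>j \<in> H\<close>, a fixed sign and a fixed \<open>x\<close>.
  Bessel's inequality bounds \<open>x \<bullet> x\<close> by \<open>4 / n\<close>, while \<open>k b\<^sub>1 \<bullet> s g\<^sub>2 = \<plusminus> k s (x \<bullet> x) / 2\<close> is an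
  integer; since \<open>k s < n / 2\<close>, \<open>x = 0\<close>. Then \<open>k b\<^sub>1\<close> and \<open>s b\<^sub>1\<close> lie in \<open>L\<close>, hence so does the unit vector
  \<open>b\<^sub>1\<close>, a contradiction.
\<close>

section \<open>Integral spans\<close>

text \<open>The real vector space is viewed as a module over the integers:
  \<open>zmod.subspace\<close> then means additive subgroup, and the general theory of spans applies
  to \<open>zspan\<close>.\<close>

interpretation zmod: module "\<lambda>(a::int) (x::'a::real_vector). of_int a *\<^sub>R x"
  by unfold_locales (simp_all add: algebra_simps)

lemma zspan_eq: "zspan S = zmod.span S"
  by (simp add: zspan_def zmod.span_explicit)

lemma zspan_subset_span: "zspan S \<subseteq> span S"
  by (auto simp: zspan_def intro!: span_sum intro: span_scale span_base)

lemma zspan_induct [consumes 1, case_names base step]: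
  assumes "x \<in> zspan S"
    and "P 0"
    and "\<And>a x y. x \<in> S \<Longrightarrow> P y \<Longrightarrow> P (of_int a *\<^sub>R x + y)"
  shows "P x"
  using assms zmod.span_induct_alt[of x S P] by (simp add: zspan_eq)

text \<open>Serves to decompose a root along the components of a splitting.\<close>

lemma zspan_Union_decompose:
  assumes "finite C" "\<And>K. K \<in> C \<Longrightarrow> zmod.subspace K" "x \<in> zspan (\<Union>C)"
  shows "\<exists>y. (\<forall>K\<in>C. y K \<in> K) \<and> x = (\<Sum>K\<in>C. y K)"
  using assms(3)
proof (induction rule: zspan_induct)
  case base
  show ?case using assms(2) zmod.subspace_0 by (intro exI[of _ "\<lambda>_. 0"]) auto
next
  case (step a x z)
  then obtain y where y: "\<forall>K\<in>C. y K \<in> K" "z = (\<Sum>K\<in>C. y K)" by blast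
  obtain M where M: "M \<in> C" "x \<in> M" using step by blast
  let ?y = "\<lambda>K. if K = M then of_int a *\<^sub>R x + y K else y K"
  have "(\<Sum>K\<in>C. ?y K) = of_int a *\<^sub>R x + z"
    using M assms(1) y(2) by (simp add: sum.remove[of C M])
  moreover have "\<forall>K\<in>C. ?y K \<in> K"
    using y(1) M zmod.subspace_add[OF assms(2)[OF M(1)] zmod.subspace_scale[OF assms(2)[OF M(1)] M(2)]]
    by simp
  ultimately show ?case by (intro exI[of _ ?y]) simp
qed

text \<open>The closure hypothesis makes \<open>D\<close> a subgroup; its least positive element
  divides every other one, by division with remainder.\<close>

lemma int_subgroup_generator:
  fixes D :: "int set"
  assumes "d0 \<in> D" "d0 \<noteq> 0" and diff: "\<And>a b q. a \<in> D \<Longrightarrow> b \<in> D \<Longrightarrow> a - q * b \<in> D"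
  obtains d where "d \<in> D" "d \<noteq> 0" "\<And>a. a \<in> D \<Longrightarrow> d dvd a"
proof -
  let ?P = "\<lambda>m::nat. m > 0 \<and> int m \<in> D"
  have "- d0 \<in> D" using diff[OF assms(1,1), of 2] by simp
  then have "?P (nat \<bar>d0\<bar>)" using assms(1,2) by (auto simp: abs_if)
  then have P: "?P (LEAST m. ?P m)" by (rule LeastI)
  define d where "d = int (LEAST m. ?P m)"
  have d: "d > 0" "d \<in> D" using P by (auto simp: d_def)
  have "d dvd a" if "a \<in> D" for a
  proof (rule ccontr)
    assume "\<not> d dvd a"
    then have pos: "a mod d > 0" using d(1) by (simp add: dvd_eq_mod_eq_0 order_less_le)
    have "a mod d \<in> D"
      using diff[OF that d(2), of "a div d"] by (simp add: minus_div_mult_eq_mod)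
    then have "?P (nat (a mod d))" using pos by simp
    then have "(LEAST m. ?P m) \<le> nat (a mod d)" by (rule Least_le)
    then have "d \<le> a mod d" using pos by (simp add: d_def le_nat_iff)
    then show False using d(1) pos_mod_bound[of d a] by linarith
  qed
  then show ?thesis using that d by force
qed

text \<open>Subgroups of a lattice are lattices. In the induction step, a basis of the part of
  \<open>M\<close> in \<open>zspan b\<close> is completed by one vector whose coordinate at the new
  basis vector generates all such coordinates.\<close>

lemma zspan_subgroup_basis:
  assumes "finite b" "independent b" "zmod.subspace M" "M \<subseteq> zspan b"
  shows "\<exists>c. finite c \<and> independent c \<and> M = zspan c"
  using assms
proof (induction b arbitrary: M)
  case empty
  then have "M = zspan {}" using zmod.subspace_0[of M] by (auto simp: zspan_eq)
  then show ?case using independent_empty by blast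
next
  case (insert x b)
  have ib: "independent b" and xb: "x \<notin> span b"
    using insert.prems(1) insert.hyps by (auto simp: independent_insert)
  have zb: "zmod.subspace (zspan b)" by (simp add: zspan_eq)
  let ?M = "M \<inter> zspan b"
  have "zmod.subspace ?M" using insert.prems(2) zb by (rule zmod.subspace_inter)
  then obtain c where c: "finite c" "independent c" "?M = zspan c"
    using insert.IH[OF ib] by blast
  \<comment> \<open>The coordinates at \<open>x\<close> of the elements of \<open>M\<close>.\<close>
  define D where "D = {a::int. \<exists>m\<in>M. m - of_int a *\<^sub>R x \<in> zspan b}"
  have Dex: "\<exists>a\<in>D. m - of_int a *\<^sub>R x \<in> zspan b" if "m \<in> M" for m
    using that insert.prems(3) by (force simp: D_def zspan_eq zmod.span_insert)
  show ?case
  proof (cases "D \<subseteq> {0}")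
    case True
    then have "M \<subseteq> zspan b" using Dex by fastforce
    then have "?M = M" by blast
    then show ?thesis using c by auto
  next
    case False
    have "a - q * a' \<in> D" if aD: "a \<in> D" "a' \<in> D" for a a' q
    proof -
      obtain m m' where "m \<in> M" "m - of_int a *\<^sub>R x \<in> zspan b"
        "m' \<in> M" "m' - of_int a' *\<^sub>R x \<in> zspan b"
        using aD by (auto simp: D_def)
      moreover have "(m - of_int q *\<^sub>R m') - of_int (a - q * a') *\<^sub>R x
        = (m - of_int a *\<^sub>R x) - of_int q *\<^sub>R (m' - of_int a' *\<^sub>R x)"
        by (simp add: algebra_simps)
      ultimately show ?thesis unfolding D_def
        using zmod.subspace_diff zmod.subspace_scale insert.prems(2) zb
        by (metis (mono_tags, lifting) mem_Collect_eq)
    qed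
    then obtain d where d: "d \<in> D" "d \<noteq> 0" "\<And>a. a \<in> D \<Longrightarrow> d dvd a"
      using False int_subgroup_generator[of _ D] by (metis singletonI subsetI)
    obtain m where m: "m \<in> M" "m - of_int d *\<^sub>R x \<in> zspan b" using d(1) by (auto simp: D_def)
    have cb: "span c \<subseteq> span b"
      using c(3) zspan_subset_span[of b] zmod.span_superset[of c]
      by (intro span_minimal) (auto simp: zspan_eq)
    \<comment> \<open>Independence is over the reals: \<open>m\<close> has the nonzero coordinate
      \<open>d\<close> at \<open>x\<close>, while \<open>span c\<close> lies in
      \<open>span b\<close>.\<close>
    have "m \<notin> span c"
    proof
      assume "m \<in> span c"
      then have "m - (m - of_int d *\<^sub>R x) \<in> span b"
        using cb m(2) zspan_subset_span by (blast intro: span_diff)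
      then have "of_int d *\<^sub>R x \<in> span b" by simp
      then show False using xb d(2) span_scale[of _ b "1 / of_int d"] by force
    qed
    then have "independent (insert m c)" using c(2) by (simp add: independent_insert)
    moreover have "M = zspan (insert m c)"
    proof
      show "zspan (insert m c) \<subseteq> M"
        unfolding zspan_eq using m(1) c(3) insert.prems(2)
        by (intro zmod.span_minimal) (auto simp: zspan_eq intro: zmod.span_base)
      show "M \<subseteq> zspan (insert m c)"
      proof
        fix y assume y: "y \<in> M"
        then obtain a where a: "a \<in> D" "y - of_int a *\<^sub>R x \<in> zspan b" using Dex by blast
        obtain q where q: "a = d * q" using d(3)[OF a(1)] by (auto simp: dvd_def)
        have eq: "y - of_int q *\<^sub>R m = (y - of_int a *\<^sub>R x) - of_int q *\<^sub>R (m - of_int d *\<^sub>R x)"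
          by (simp add: q algebra_simps)
        have "y - of_int q *\<^sub>R m \<in> zspan b"
          unfolding eq by (intro zmod.subspace_diff zmod.subspace_scale zb a m)
        moreover have "y - of_int q *\<^sub>R m \<in> M"
          by (intro zmod.subspace_diff zmod.subspace_scale insert.prems y m)
        ultimately have "y - of_int q *\<^sub>R m \<in> zspan c" using c(3) by blast
        then show "y \<in> zspan (insert m c)" by (auto simp: zspan_eq zmod.span_insert)
      qed
    qed
    ultimately show ?thesis using c(1) by blast
  qed
qed

section \<open>Lattices\<close>

lemma zlattice_subspace: "zlattice L \<Longrightarrow> zmod.subspace L"
  by (auto simp: zlattice_def zspan_eq)

lemma zlattice_inner_Ints:
  assumes "zlattice L" "x \<in> L" "y \<in> L"
  shows "x \<bullet> y \<in> \<int>"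
proof -
  obtain b where b: "L = zspan b" "\<And>x y. x \<in> b \<Longrightarrow> y \<in> b \<Longrightarrow> x \<bullet> y \<in> \<int>"
    using assms(1) by (auto simp: zlattice_def)
  have 1: "u \<bullet> y \<in> \<int>" if "u \<in> b" for u
    using assms(3) unfolding b(1)
    by (induction rule: zspan_induct) (auto simp: inner_add_right intro!: Ints_add Ints_mult b(2) that)
  show ?thesis
    using assms(2) unfolding b(1)
    by (induction rule: zspan_induct) (auto simp: inner_add_left intro!: Ints_add Ints_mult 1)
qed

lemma zlattice_sublattice:
  assumes "zlattice L" "zmod.subspace M" "M \<subseteq> L"
  shows "zlattice M"
proof -
  obtain b where "finite b" "independent b" "L = zspan b"
    using assms(1) by (auto simp: zlattice_def)
  then obtain c where c: "finite c" "independent c" "M = zspan c"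
    using zspan_subgroup_basis assms(2,3) by blast
  have "c \<subseteq> L" using c(3) assms(3) zmod.span_superset[of c] by (auto simp: zspan_eq)
  then have "\<forall>x\<in>c. \<forall>y\<in>c. x \<bullet> y \<in> \<int>" using zlattice_inner_Ints[OF assms(1)] by blast
  then show ?thesis using c by (auto simp: zlattice_def)
qed

text \<open>Norms in a lattice are natural numbers, so well-ordering shows that the real-valued
  \<open>LEAST\<close> is attained.\<close>

lemma lattice_min_le:
  assumes "zlattice L" "x \<in> L" "x \<noteq> 0"
  shows "lattice_min L \<le> x \<bullet> x"
proof -
  let ?P = "\<lambda>m::nat. \<exists>x\<in>L. x \<noteq> 0 \<and> real m = x \<bullet> x"
  have nat: "\<exists>m. real m = y \<bullet> y" if y: "y \<in> L" for y
  proof -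
    obtain z where z: "y \<bullet> y = of_int z"
      using zlattice_inner_Ints[OF assms(1) y y] by (rule Ints_cases)
    then have "real (nat z) = y \<bullet> y" using inner_ge_zero[of y] by simp
    then show ?thesis by blast
  qed
  then have "\<exists>m. ?P m" using assms by blast
  then have P: "?P (LEAST m. ?P m)" by (rule LeastI_ex)
  have le: "real (LEAST m. ?P m) \<le> y \<bullet> y" if y: "y \<in> L" "y \<noteq> 0" for y
  proof -
    obtain m where m: "real m = y \<bullet> y" using nat[OF y(1)] by blast
    then have "(LEAST m. ?P m) \<le> m" using y by (intro Least_le) auto
    then show ?thesis unfolding m[symmetric] by (rule of_nat_mono)
  qed
  have "lattice_min L = real (LEAST m. ?P m)"
    unfolding lattice_min_def by (rule Least_equality) (use P le in auto)
  then show ?thesis using le assms by simp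
qed

text \<open>Induction on the dimension: an orthogonal summand has smaller dimension, because a
  nonzero vector of the other summand is outside its real span. The zero lattice gets the empty
  splitting.\<close>

lemma indecomposable_splitting_exists:
  fixes M :: "'a::euclidean_space set"
  assumes "zlattice M"
  shows "\<exists>C. indecomposable_splitting M C"
  using assms
proof (induction "dim M" arbitrary: M rule: less_induct)
  case less
  consider "M = {0}" | "indecomposable M" | "M \<noteq> {0}" "\<not> indecomposable M" by blast
  then show ?case
  proof cases
    case 1
    then have "indecomposable_splitting M {}" by (simp add: indecomposable_splitting_def zspan_eq)
    then show ?thesis by blast
  next
    case 2
    then have "indecomposable_splitting M {M}"
      using zlattice_subspace[OF less.prems]
      by (simp add: indecomposable_splitting_def zspan_eq zmod.span_eq_iff[THEN iffD2])
    then show ?thesis by blast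
  next
    case 3
    then obtain M1 M2 where M: "zlattice M1" "zlattice M2" "M1 \<noteq> {0}" "M2 \<noteq> {0}"
      "orthogonal_lattices M1 M2" "M = zspan (M1 \<union> M2)"
      using less.prems by (auto simp: indecomposable_def)
    have sub: "M1 \<subseteq> M" "M2 \<subseteq> M"
      using zmod.span_superset[of "M1 \<union> M2"] by (auto simp: M(6) zspan_eq)
    have smaller: "dim N < dim M"
      if N: "zlattice N'" "N' \<noteq> {0}" "N \<subseteq> M" "N' \<subseteq> M" "orthogonal_lattices N' N"
      for N N'
    proof -
      obtain y where y: "y \<in> N'" "y \<noteq> 0"
        using N(1,2) zlattice_subspace zmod.subspace_0 by blast
      have "y \<notin> span N"
      proof
        assume "y \<in> span N"
        then have "orthogonal y y"
          by (rule orthogonal_to_span) (use N(5) y(1) in \<open>auto simp: orthogonal_def orthogonal_lattices_def\<close>)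
        then show False using y(2) by (simp add: orthogonal_self)
      qed
      moreover have "y \<in> span M" using y N(4) by (auto intro: span_base)
      ultimately have "span N \<subset> span M" using span_mono[OF N(3)] by blast
      then show ?thesis by (rule dim_psubset)
    qed
    have "orthogonal_lattices M2 M1"
      using M(5) unfolding orthogonal_lattices_def by (metis inner_commute)
    then have "dim M1 < dim M" "dim M2 < dim M"
      using smaller M sub by blast+
    then obtain C1 C2 where C: "indecomposable_splitting M1 C1" "indecomposable_splitting M2 C2"
      using less.hyps M by metis
    have sup: "K \<subseteq> M1" if "K \<in> C1" for K
      using C(1) that zmod.span_superset[of "\<Union>C1"] by (auto simp: indecomposable_splitting_def zspan_eq)
    have sup': "K \<subseteq> M2" if "K \<in> C2" for K
      using C(2) that zmod.span_superset[of "\<Union>C2"] by (auto simp: indecomposable_splitting_def zspan_eq)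
    have "pairwise orthogonal_lattices (C1 \<union> C2)"
      unfolding pairwise_def
    proof (intro ballI impI)
      fix K K' assume K: "K \<in> C1 \<union> C2" "K' \<in> C1 \<union> C2" "K \<noteq> K'"
      consider "K \<in> C1" "K' \<in> C1" | "K \<in> C2" "K' \<in> C2" | "K \<in> C1" "K' \<in> C2" | "K \<in> C2" "K' \<in> C1"
        using K by blast
      then show "orthogonal_lattices K K'"
      proof cases
        case 1 then show ?thesis using C K(3) by (auto simp: indecomposable_splitting_def pairwise_def)
      next
        case 2 then show ?thesis using C K(3) by (auto simp: indecomposable_splitting_def pairwise_def)
      next
        case 3 then show ?thesis using M(5) sup sup' unfolding orthogonal_lattices_def by blast
      next
        case 4 then show ?thesis using \<open>orthogonal_lattices M2 M1\<close> sup sup'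
          unfolding orthogonal_lattices_def by blast
      qed
    qed
    moreover have "M = zspan (\<Union>(C1 \<union> C2))"
    proof -
      have e: "M1 = zspan (\<Union>C1)" "M2 = zspan (\<Union>C2)"
        using C by (simp_all add: indecomposable_splitting_def)
      show ?thesis unfolding M(6) Union_Un_distrib zspan_eq
      proof (rule zmod.span_unique[symmetric])
        show "\<Union>C1 \<union> \<Union>C2 \<subseteq> zmod.span (M1 \<union> M2)"
          using sup sup' zmod.span_superset[of "M1 \<union> M2"] by blast
      next
        fix T assume T: "\<Union>C1 \<union> \<Union>C2 \<subseteq> T" "zmod.subspace T"
        have "M1 \<subseteq> T" "M2 \<subseteq> T" unfolding e zspan_eq using T by (auto intro!: zmod.span_minimal del: subsetI)
        then show "zmod.span (M1 \<union> M2) \<subseteq> T" using T(2) by (intro zmod.span_minimal) auto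
      qed simp
    qed
    ultimately have "indecomposable_splitting M (C1 \<union> C2)"
      using C by (auto simp: indecomposable_splitting_def)
    then show ?thesis by blast
  qed
qed

section \<open>Orthonormal families\<close>

lemma orthonormal_bessel:
  assumes "orthonormal_family n b"
  shows "(\<Sum>i=1..n. (x \<bullet> b i)\<^sup>2) \<le> x \<bullet> x"
proof -
  \<comment> \<open>The orthogonal projection of \<open>x\<close> onto the span of the
    family.\<close>
  define y where "y = (\<Sum>i=1..n. (x \<bullet> b i) *\<^sub>R b i)"
  have yb: "y \<bullet> b j = x \<bullet> b j" if "j \<in> {1..n}" for j
  proof -
    have "y \<bullet> b j = (\<Sum>i=1..n. if i = j then x \<bullet> b i else 0)"
      unfolding y_def inner_sum_left
      using assms that by (intro sum.cong) (auto simp: orthonormal_family_def)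
    then show ?thesis using that by simp
  qed
  have xy: "x \<bullet> y = (\<Sum>i=1..n. (x \<bullet> b i)\<^sup>2)"
    by (simp add: y_def inner_sum_right power2_eq_square)
  have "y \<bullet> y = (\<Sum>i=1..n. (x \<bullet> b i) * (y \<bullet> b i))"
    by (subst (2) y_def) (simp add: inner_sum_right)
  also have "\<dots> = (\<Sum>i=1..n. (x \<bullet> b i)\<^sup>2)"
    by (intro sum.cong) (auto simp: yb power2_eq_square)
  finally have yy: "y \<bullet> y = (\<Sum>i=1..n. (x \<bullet> b i)\<^sup>2)" .
  have "0 \<le> (x - y) \<bullet> (x - y)" by simp
  then show ?thesis using xy yy by (simp add: inner_diff inner_commute)
qed


section \<open>Frames\<close>

text \<open>Bezout. It is applied with \<open>m = 2\<close> to sums of two vectors of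
  \<open>H\<close>, and to the pair \<open>s\<close>, \<open>k\<close> in the final
  contradiction.\<close>

lemma coprime_scale_mem:
  fixes h :: "'a::real_vector"
  assumes "zmod.subspace L" "coprime k m" "of_nat k *\<^sub>R h \<in> L" "of_nat m *\<^sub>R h \<in> L"
  shows "h \<in> L"
proof -
  obtain u v where uv: "u * int k + v * int m = 1"
    using assms(2) bezout_int[of "int k" "int m"] by (auto simp: coprime_iff_gcd_eq_1)
  have "of_int u *\<^sub>R (of_nat k *\<^sub>R h) + of_int v *\<^sub>R (of_nat m *\<^sub>R h) \<in> L"
    by (intro zmod.subspace_add zmod.subspace_scale assms)
  also have "of_int u *\<^sub>R (of_nat k *\<^sub>R h) + of_int v *\<^sub>R (of_nat m *\<^sub>R h)
      = of_int (u * int k + v * int m) *\<^sub>R h"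
    by (simp add: algebra_simps)
  finally show ?thesis by (simp add: uv)
qed

declare One_nat_def [simp del]

text \<open>Common setting for both representations: \<open>f i\<close> is the vector to which
  \<open>e i\<close> would be sent. Only differences and \<open>k\<close>-fold multiples of these
  unit vectors lie in \<open>L\<close>.\<close>

locale root_frame =
  fixes L :: "'a::euclidean_space set" and f :: "nat \<Rightarrow> 'a" and n k :: nat
  assumes lattice: "zlattice L"
    and min: "x \<in> L \<Longrightarrow> x \<noteq> 0 \<Longrightarrow> x \<bullet> x \<ge> 2"
    and frame: "orthonormal_family n f"
    and frame_diff: "i \<in> {1..n} \<Longrightarrow> j \<in> {1..n} \<Longrightarrow> f i - f j \<in> L"
    and frame_scale: "i \<in> {1..n} \<Longrightarrow> of_nat k *\<^sub>R f i \<in> L"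
    and odd: "odd k"
    and bound: "2 * k\<^sup>2 < n"
begin

lemma subspace: "zmod.subspace L"
  using lattice by (rule zlattice_subspace)

lemmas diff_mem = zmod.subspace_diff[OF subspace]
  and add_mem = zmod.subspace_add[OF subspace]
  and neg_mem = zmod.subspace_neg[OF subspace]

lemma inner_Ints: "x \<in> L \<Longrightarrow> y \<in> L \<Longrightarrow> x \<bullet> y \<in> \<int>"
  using zlattice_inner_Ints[OF lattice] .

lemma n_ge_3: "3 \<le> n"
proof -
  have "1 \<le> k\<^sup>2" using odd by (cases k) auto
  then show ?thesis using bound by linarith
qed

lemma index_mem: "1 \<in> {1..n}" "2 \<in> {1..n}"
  using n_ge_3 by auto

section \<open>Unit vectors congruent to the frame modulo the lattice\<close>

definition H :: "'a set" where
  "H = {h. h \<bullet> h = 1 \<and> f 1 - h \<in> L}"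

text \<open>Once \<open>H\<close> is known to be orthonormal, this is a root lattice of type A whose
  rank is one less than the size of \<open>H\<close>.\<close>

definition R :: "'a set" where
  "R = zspan {h - h' | h h'. h \<in> H \<and> h' \<in> H}"

lemma frame_inner: "i \<in> {1..n} \<Longrightarrow> j \<in> {1..n} \<Longrightarrow> f i \<bullet> f j = (if i = j then 1 else 0)"
  using frame by (simp add: orthonormal_family_def)

lemma frame_in_H: "i \<in> {1..n} \<Longrightarrow> f i \<in> H"
  using frame_diff[OF index_mem(1)] by (simp add: H_def frame_inner)

lemma H_unit: "h \<in> H \<Longrightarrow> h \<bullet> h = 1"
  by (simp add: H_def)

lemma H_diff:
  assumes "h \<in> H" "h' \<in> H"
  shows "h - h' \<in> L"
proof -
  have "(f 1 - h') - (f 1 - h) \<in> L" by (rule diff_mem) (use assms in \<open>auto simp: H_def\<close>)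
  then show ?thesis by simp
qed

lemma H_scale:
  assumes "h \<in> H"
  shows "of_nat k *\<^sub>R h \<in> L"
proof -
  have "f 1 - h \<in> L" using assms by (simp add: H_def)
  then have "of_nat k *\<^sub>R f 1 - of_int (int k) *\<^sub>R (f 1 - h) \<in> L"
    using diff_mem[OF frame_scale[OF index_mem(1)] zmod.subspace_scale[OF subspace]] by blast
  then show ?thesis by (simp add: algebra_simps)
qed

lemma H_not_in_L: "h \<in> H \<Longrightarrow> h \<notin> L"
  using min[of h] H_unit[of h] by fastforce

text \<open>Adding \<open>h - h'\<close> would put \<open>2 h\<close> into \<open>L\<close>; as
  \<open>k h\<close> is in \<open>L\<close> with \<open>k\<close> odd, the unit vector
  \<open>h\<close> would be in \<open>L\<close>.\<close>

lemma H_sum: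
  assumes "h \<in> H" "h' \<in> H"
  shows "h + h' \<notin> L"
proof
  assume "h + h' \<in> L"
  then have "(h + h') + (h - h') \<in> L" using H_diff[OF assms] by (rule add_mem)
  then have "of_nat 2 *\<^sub>R h \<in> L" by (simp add: scaleR_2)
  moreover have "coprime k 2" using odd by simp
  ultimately show False
    using coprime_scale_mem[OF subspace] H_scale H_not_in_L assms(1) by blast
qed

text \<open>The norm of \<open>h - h'\<close> is an integer and at least 2, and
  \<open>h + h'\<close> is nonzero; this leaves only the inner products 0 and -1/2.\<close>

lemma H_orthogonal:
  assumes h: "h \<in> H" "h' \<in> H" "h \<noteq> h'"
  shows "h \<bullet> h' = 0"
proof -
  define t where "t = h \<bullet> h'"
  have norm_diff: "(h - h') \<bullet> (h - h') = 2 - 2 * t" and norm_add: "(h + h') \<bullet> (h + h') = 2 + 2 * t"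
    using H_unit[OF h(1)] H_unit[OF h(2)]
    by (simp_all add: inner_diff inner_add inner_commute t_def)
  have "t \<le> 0" using min[OF H_diff[OF h(1,2)]] h(3) norm_diff by simp
  moreover have "t > -1"
  proof -
    have "h + h' \<noteq> 0" using H_sum[OF h(1,2)] zmod.subspace_0[OF subspace] by metis
    then have "(h + h') \<bullet> (h + h') > 0" by simp
    then show ?thesis using norm_add by simp
  qed
  moreover have "2 * t \<in> \<int>"
  proof -
    have "2 - (2 - 2 * t) \<in> \<int>"
      using inner_Ints[OF H_diff[OF h(1,2)] H_diff[OF h(1,2)]] norm_diff
      by (intro Ints_diff) auto
    then show ?thesis by simp
  qed
  then obtain z where z: "2 * t = of_int z" by (rule Ints_cases)
  ultimately have "z \<in> {-1, 0}" by auto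
  \<comment> \<open>Parity of \<open>k\<close> excludes -1/2: the lattice vectors \<open>k h\<close>
    and \<open>h - h'\<close> would have inner product \<open>3 k / 2\<close>.\<close>
  moreover have "z \<noteq> -1"
  proof
    assume "z = -1"
    then have "t = -1/2" using z by simp
    then have "(of_nat k *\<^sub>R h) \<bullet> (h - h') = 3 * real k / 2"
      using H_unit[OF h(1)] by (simp add: inner_diff_right t_def)
    then have "3 * real k / 2 \<in> \<int>" using inner_Ints H_scale H_diff h by metis
    then obtain w where "3 * real k / 2 = of_int w" by (rule Ints_cases)
    then have "3 * int k = 2 * w" by linarith
    then show False using odd by presburger
  qed
  ultimately show ?thesis using z by (auto simp: t_def)
qed

lemma H_inner: "h \<in> H \<Longrightarrow> h' \<in> H \<Longrightarrow> h \<bullet> h' = (if h = h' then 1 else 0)"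
  using H_orthogonal H_unit by auto

text \<open>Here the hypothesis \<open>2 * k\<^sup>2 < n\<close> enters: otherwise every \<open>\<alpha> \<bullet> f i\<close> is a nonzero multiple
  of \<open>1 / k\<close>, against Bessel's inequality.\<close>

lemma root_orthogonal_frame_vector:
  assumes "\<alpha> \<in> L" "\<alpha> \<bullet> \<alpha> = 2"
  shows "\<exists>i\<in>{1..n}. \<alpha> \<bullet> f i = 0"
proof (rule ccontr)
  assume "\<not> ?thesis"
  then have nz: "\<alpha> \<bullet> f i \<noteq> 0" if "i \<in> {1..n}" for i using that by blast
  have kpos: "real k > 0" using odd by (cases k) auto
  have "1 / (real k)\<^sup>2 \<le> (\<alpha> \<bullet> f i)\<^sup>2" if i: "i \<in> {1..n}" for i
  proof -
    have "\<alpha> \<bullet> (of_nat k *\<^sub>R f i) \<in> \<int>" using inner_Ints assms(1) frame_scale[OF i] by blast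
    then have "real k * (\<alpha> \<bullet> f i) \<in> \<int>" by simp
    then have "1 \<le> \<bar>real k * (\<alpha> \<bullet> f i)\<bar>" using nz[OF i] kpos by (intro Ints_nonzero_abs_ge1) auto
    then have "1 \<le> (real k * (\<alpha> \<bullet> f i))\<^sup>2" by (metis one_le_power power2_abs)
    then show ?thesis using kpos by (simp add: power_mult_distrib field_simps)
  qed
  then have "(\<Sum>i=1..n. 1 / (real k)\<^sup>2) \<le> (\<Sum>i=1..n. (\<alpha> \<bullet> f i)\<^sup>2)" by (intro sum_mono)
  also have "\<dots> \<le> 2" using orthonormal_bessel[OF frame, of \<alpha>] assms(2) by simp
  finally have "real n \<le> 2 * (real k)\<^sup>2" using kpos by (simp add: field_simps)
  then have "n \<le> 2 * k\<^sup>2" by (metis of_nat_le_iff of_nat_mult of_nat_numeral of_nat_power)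
  then show False using bound by simp
qed

text \<open>Some \<open>f i\<close> is orthogonal to \<alpha>, and \<open>h - f i\<close> is in
  \<open>L\<close>, so the product of \<alpha> with \<open>h\<close> is an integer. By
  Cauchy-Schwarz it is -1, 0 or 1.\<close>

lemma root_dichotomy:
  assumes \<alpha>: "\<alpha> \<in> L" "\<alpha> \<bullet> \<alpha> = 2"
  shows "(\<forall>h\<in>H. \<alpha> \<bullet> h = 0) \<or> (\<exists>h\<in>H. \<exists>h'\<in>H. h \<noteq> h' \<and> \<alpha> = h - h')"
proof -
  \<comment> \<open>Here \<open>h - \<alpha>\<close> is the image of \<open>h\<close> under the
    reflection in \<alpha>: again a unit vector, and in the same class modulo
    \<open>L\<close>.\<close>
  have key: "\<exists>h'\<in>H. h \<noteq> h' \<and> \<alpha> = h - h'"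
    if "\<alpha> \<in> L" "\<alpha> \<bullet> \<alpha> = 2" "h \<in> H" "\<alpha> \<bullet> h = 1" for \<alpha> h
  proof -
    have "(h - \<alpha>) \<bullet> (h - \<alpha>) = 1"
      using that H_unit[of h] by (simp add: inner_diff inner_commute)
    moreover have "(f 1 - h) + \<alpha> \<in> L" using that by (intro add_mem) (auto simp: H_def)
    ultimately have "h - \<alpha> \<in> H" by (simp add: H_def algebra_simps)
    moreover have "\<alpha> \<noteq> 0" using that by auto
    ultimately show ?thesis by (intro bexI[of _ "h - \<alpha>"]) auto
  qed
  show ?thesis
  proof (cases "\<forall>h\<in>H. \<alpha> \<bullet> h = 0")
    case False
    then obtain h where h: "h \<in> H" "\<alpha> \<bullet> h \<noteq> 0" by blast
    obtain i where i: "i \<in> {1..n}" "\<alpha> \<bullet> f i = 0" using root_orthogonal_frame_vector[OF \<alpha>] by blast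
    have "\<alpha> \<bullet> (h - f i) \<in> \<int>" using inner_Ints \<alpha> H_diff h frame_in_H i by blast
    then have "\<alpha> \<bullet> h \<in> \<int>" using i by (simp add: inner_diff_right)
    then obtain z where z: "\<alpha> \<bullet> h = of_int z" by (rule Ints_cases)
    have "(\<alpha> \<bullet> h)\<^sup>2 \<le> (\<alpha> \<bullet> \<alpha>) * (h \<bullet> h)" by (rule Cauchy_Schwarz_ineq)
    then have "real_of_int (z\<^sup>2) \<le> 2" using z \<alpha> H_unit[OF h(1)] by simp
    then have "z\<^sup>2 \<le> 2" by linarith
    have "\<bar>z\<bar> < 2"
    proof (rule ccontr)
      assume "\<not> \<bar>z\<bar> < 2"
      then have "2\<^sup>2 \<le> \<bar>z\<bar>\<^sup>2" by (intro power_mono) auto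
      then show False using \<open>z\<^sup>2 \<le> 2\<close> by simp
    qed
    then consider "z = 1" | "z = -1" using h(2) z by fastforce
    then show ?thesis
    proof cases
      case 1
      then show ?thesis using key[OF \<alpha> h(1)] h z by auto
    next
      case 2
      then obtain h' where "h' \<in> H" "h \<noteq> h'" "- \<alpha> = h - h'"
        using key[OF neg_mem, OF \<alpha>(1) _ h(1)] \<alpha> h z by auto
      then show ?thesis using h(1) by (metis minus_diff_eq minus_minus)
    qed
  qed blast
qed

section \<open>The component of the root lattice that contains the frame differences\<close>

lemma root_sublattice_eq: "root_sublattice L = zspan {\<alpha> \<in> L. \<alpha> \<bullet> \<alpha> = 2}"
proof -
  have "{x \<in> L. x \<bullet> x = 1 \<or> x \<bullet> x = 2} = {\<alpha> \<in> L. \<alpha> \<bullet> \<alpha> = 2}"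
    using min by fastforce
  then show ?thesis by (simp add: root_sublattice_def)
qed

lemma root_sublattice_subset: "root_sublattice L \<subseteq> L"
  unfolding root_sublattice_def zspan_eq by (rule zmod.span_minimal) (auto intro: subspace)

lemma root_sublattice_lattice: "zlattice (root_sublattice L)"
  by (rule zlattice_sublattice[OF lattice _ root_sublattice_subset])
    (simp add: root_sublattice_def zspan_eq)

lemma H_diff_root: "h \<in> H \<Longrightarrow> h' \<in> H \<Longrightarrow> h \<noteq> h' \<Longrightarrow> (h - h') \<bullet> (h - h') = 2"
  by (simp add: inner_diff H_inner)

lemma H_diff_in_R: "h \<in> H \<Longrightarrow> h' \<in> H \<Longrightarrow> h - h' \<in> R"
  unfolding R_def zspan_eq by (rule zmod.span_base) auto

lemma R_subset: "R \<subseteq> L"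
  unfolding R_def zspan_eq by (rule zmod.span_minimal) (auto intro: H_diff subspace)

text \<open>A root of \<open>R\<close> orthogonal to \<open>H\<close> would be orthogonal to all of
  \<open>R\<close>, hence to itself, so only the second case of the dichotomy remains.\<close>

lemma root_in_R:
  assumes "\<alpha> \<in> R" "\<alpha> \<bullet> \<alpha> = 2"
  shows "\<exists>h\<in>H. \<exists>h'\<in>H. h \<noteq> h' \<and> \<alpha> = h - h'"
proof -
  have "\<alpha> \<bullet> x = 0" if "\<forall>h\<in>H. \<alpha> \<bullet> h = 0" "x \<in> R" for x
    using that(2) unfolding R_def
    by (induction rule: zspan_induct) (auto simp: inner_add_right inner_diff_right that(1))
  then have "\<not> (\<forall>h\<in>H. \<alpha> \<bullet> h = 0)" using assms by fastforce
  then show ?thesis using root_dichotomy assms R_subset by blast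
qed

context
  fixes C assumes split: "indecomposable_splitting (root_sublattice L) C"
begin

lemma component_subspace: "K \<in> C \<Longrightarrow> zmod.subspace K"
  using split by (auto simp: indecomposable_splitting_def indecomposable_def zlattice_subspace)

lemma component_subset: "K \<in> C \<Longrightarrow> K \<subseteq> root_sublattice L"
  using split zmod.span_superset[of "\<Union>C"] by (auto simp: indecomposable_splitting_def zspan_eq)

lemma component_orthogonal:
  "K \<in> C \<Longrightarrow> K' \<in> C \<Longrightarrow> K \<noteq> K' \<Longrightarrow> x \<in> K \<Longrightarrow> y \<in> K' \<Longrightarrow> x \<bullet> y = 0"
  using split by (auto simp: indecomposable_splitting_def pairwise_def orthogonal_lattices_def)

text \<open>A root does not split, since every nonzero vector of \<open>L\<close> has norm at least \<open>2\<close>.\<close>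

lemma root_in_component:
  assumes "\<alpha> \<in> L" "\<alpha> \<bullet> \<alpha> = 2"
  obtains K where "K \<in> C" "\<alpha> \<in> K"
proof -
  have fin: "finite C" using split by (simp add: indecomposable_splitting_def)
  have "\<alpha> \<in> root_sublattice L"
    unfolding root_sublattice_def zspan_eq using assms by (intro zmod.span_base) auto
  then have "\<alpha> \<in> zspan (\<Union>C)" using split by (simp add: indecomposable_splitting_def)
  then obtain y where y: "\<forall>K\<in>C. y K \<in> K" "\<alpha> = (\<Sum>K\<in>C. y K)"
    using zspan_Union_decompose[OF fin component_subspace] by blast
  obtain K where K: "K \<in> C" "y K \<noteq> 0"
    using assms(2) y(2) by (metis inner_zero_left sum.neutral zero_neq_numeral)
  have "\<alpha> \<bullet> y K = (\<Sum>K'\<in>C. if K' = K then y K \<bullet> y K else 0)"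
    unfolding y(2) inner_sum_left using y(1) K(1) component_orthogonal by (intro sum.cong) auto
  then have ip: "\<alpha> \<bullet> y K = y K \<bullet> y K" using K(1) fin by simp
  have "y K \<bullet> y K \<ge> 2"
    using min K y(1) component_subset root_sublattice_subset by blast
  then have "(\<alpha> - y K) \<bullet> (\<alpha> - y K) \<le> 0"
    using ip assms(2) by (simp add: inner_diff inner_commute)
  then have "\<alpha> = y K" by (metis antisym inner_eq_zero_iff inner_ge_zero right_minus_eq)
  then show ?thesis using that K(1) y(1) by metis
qed

text \<open>Write an element of \<open>K\<close> as a combination of roots, each of which lies in
  one component. The terms from other components are orthogonal to \<open>K\<close>, and their sum
  is in \<open>K\<close>, so it vanishes.\<close>

lemma component_roots_span:
  assumes "K \<in> C"
  shows "K \<subseteq> zspan {\<alpha> \<in> K. \<alpha> \<bullet> \<alpha> = 2}"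
proof
  fix x assume x: "x \<in> K"
  let ?S = "zspan {\<alpha> \<in> K. \<alpha> \<bullet> \<alpha> = 2}"
  have S: "zmod.subspace ?S" by (simp add: zspan_eq)
  have SK: "?S \<subseteq> K"
    unfolding zspan_eq by (rule zmod.span_minimal) (use component_subspace[OF assms] in auto)
  have "x \<in> zspan {\<alpha> \<in> L. \<alpha> \<bullet> \<alpha> = 2}"
    using x component_subset[OF assms] root_sublattice_eq by blast
  \<comment> \<open>\<open>u\<close> collects the terms whose roots lie in \<open>K\<close>.\<close>
  then have "\<exists>u\<in>?S. \<forall>z\<in>K. (x - u) \<bullet> z = 0"
  proof (induction rule: zspan_induct)
    case base
    show ?case using zmod.subspace_0[OF S] by (intro bexI[of _ 0]) auto
  next
    case (step a \<alpha> y)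
    then obtain u where u: "u \<in> ?S" "\<forall>z\<in>K. (y - u) \<bullet> z = 0" by blast
    obtain K' where K': "K' \<in> C" "\<alpha> \<in> K'" using root_in_component step by blast
    show ?case
    proof (cases "K' = K")
      case True
      then have "\<alpha> \<in> ?S" using K' step by (auto simp: zspan_eq intro: zmod.span_base)
      then have "of_int a *\<^sub>R \<alpha> + u \<in> ?S"
        by (intro zmod.subspace_add zmod.subspace_scale S u)
      then show ?thesis using u by (intro bexI[of _ "of_int a *\<^sub>R \<alpha> + u"]) auto
    next
      case False
      then have "\<forall>z\<in>K. \<alpha> \<bullet> z = 0" using component_orthogonal K' assms by blast
      then show ?thesis using u by (intro bexI[of _ u]) (auto simp: inner_diff_left inner_add_left)
    qed
  qed
  then obtain u where u: "u \<in> ?S" "\<forall>z\<in>K. (x - u) \<bullet> z = 0" by blast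
  have "x - u \<in> K" using zmod.subspace_diff component_subspace assms x u SK by blast
  then have "(x - u) \<bullet> (x - u) = 0" using u by blast
  then show "x \<in> ?S" using u by simp
qed

text \<open>For \<open>h\<close> other than \<open>f 1\<close> and \<open>f 2\<close>, the roots
  \<open>f 1 - h\<close> and \<open>f 1 - f 2\<close> have inner product 1, so they cannot lie in
  different components.\<close>

lemma R_subset_component:
  assumes K: "K \<in> C" "f 1 - f 2 \<in> K"
  shows "R \<subseteq> K"
proof -
  note sub = component_subspace[OF K(1)]
  have fH: "f 1 \<in> H" "f 2 \<in> H" using frame_in_H index_mem by auto
  have h1: "f 1 - h \<in> K" if h: "h \<in> H" for h
  proof (cases "h = f 1 \<or> h = f 2")
    case True
    then show ?thesis using K zmod.subspace_0[OF sub] by auto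
  next
    case False
    have "(f 1 - h) \<bullet> (f 1 - h) = 2" using H_diff_root h fH False by blast
    then obtain K' where K': "K' \<in> C" "f 1 - h \<in> K'"
      using root_in_component H_diff h fH by blast
    have "f 1 \<noteq> f 2" using frame_inner[of 1 2] frame_inner[of 1 1] index_mem by auto
    then have "(f 1 - h) \<bullet> (f 1 - f 2) = 1"
      using False H_inner[OF fH(1) fH(1)] H_inner[OF fH] H_inner[OF h fH(1)] H_inner[OF h fH(2)]
      by (simp add: inner_diff inner_commute)
    then have "K' = K" using component_orthogonal[OF K'(1) K(1) _ K'(2) K(2)] by fastforce
    then show ?thesis using K' by simp
  qed
  have "h - h' \<in> K" if "h \<in> H" "h' \<in> H" for h h'
  proof -
    have "(f 1 - h') - (f 1 - h) \<in> K" by (intro zmod.subspace_diff sub h1 that)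
    then show ?thesis by simp
  qed
  then show ?thesis unfolding R_def zspan_eq using sub by (intro zmod.span_minimal) auto
qed

text \<open>By the dichotomy, \<open>K\<close> is the orthogonal sum of \<open>R\<close> and the
  span of its roots orthogonal to \<open>H\<close>. Indecomposability makes the second summand
  zero.\<close>

lemma component_eq_R:
  assumes K: "K \<in> C" "f 1 - f 2 \<in> K"
  shows "K = R"
proof -
  let ?T = "{\<alpha> \<in> K. \<alpha> \<bullet> \<alpha> = 2 \<and> (\<forall>h\<in>H. \<alpha> \<bullet> h = 0)}"
  note sub = component_subspace[OF K(1)] and RK = R_subset_component[OF K]
  have KL: "K \<subseteq> L" using component_subset[OF K(1)] root_sublattice_subset by blast
  have Rsub: "zmod.subspace R" "zmod.subspace (zspan ?T)" by (simp_all add: R_def zspan_eq)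
  have TK: "zspan ?T \<subseteq> K" unfolding zspan_eq using sub by (intro zmod.span_minimal) auto
  have eq: "K = zspan (R \<union> zspan ?T)"
  proof
    show "zspan (R \<union> zspan ?T) \<subseteq> K"
      unfolding zspan_eq using RK TK sub by (intro zmod.span_minimal) (auto simp: zspan_eq)
    have "{\<alpha> \<in> K. \<alpha> \<bullet> \<alpha> = 2} \<subseteq> R \<union> zspan ?T"
    proof
      fix \<alpha> assume \<alpha>: "\<alpha> \<in> {\<alpha> \<in> K. \<alpha> \<bullet> \<alpha> = 2}"
      then consider "\<forall>h\<in>H. \<alpha> \<bullet> h = 0" | "\<alpha> \<in> R"
        using root_dichotomy KL H_diff_in_R by blast
      then show "\<alpha> \<in> R \<union> zspan ?T"
        using \<alpha> zmod.span_superset[of ?T] by cases (auto simp: zspan_eq)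
    qed
    then have "zspan {\<alpha> \<in> K. \<alpha> \<bullet> \<alpha> = 2} \<subseteq> zspan (R \<union> zspan ?T)"
      unfolding zspan_eq by (rule zmod.span_mono)
    with component_roots_span[OF K(1)] show "K \<subseteq> zspan (R \<union> zspan ?T)" by (rule order_trans)
  qed
  have "orthogonal_lattices R (zspan ?T)"
    unfolding orthogonal_lattices_def
  proof (intro ballI)
    fix x y assume xy: "x \<in> R" "y \<in> zspan ?T"
    have y: "h \<bullet> y = 0" if "h \<in> H" for h
      using xy(2) by (induction rule: zspan_induct) (auto simp: inner_add_right inner_commute[of h] that)
    show "x \<bullet> y = 0"
      using xy(1) unfolding R_def
      by (induction rule: zspan_induct) (auto simp: inner_add_left inner_diff_left y)
  qed
  moreover have "zlattice R" "zlattice (zspan ?T)"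
    using zlattice_sublattice[OF lattice] Rsub R_subset order_trans[OF TK KL] by auto
  moreover have "R \<noteq> {0}"
  proof
    assume "R = {0}"
    then have "f 1 - f 2 = 0" using H_diff_in_R[OF frame_in_H frame_in_H, OF index_mem] by simp
    then show False using frame_inner[of 1 2] frame_inner[of 1 1] index_mem by auto
  qed
  ultimately have "\<not> indecomposable K" if "zspan ?T \<noteq> {0}"
    unfolding indecomposable_def
    by (intro notI, elim conjE notE, intro exI[of _ R] exI[of _ "zspan ?T"] conjI eq that) auto
  moreover have "indecomposable K" using split K(1) by (simp add: indecomposable_splitting_def)
  ultimately have T: "zspan ?T = {0}" by blast
  have "R \<union> {0} = R" using zmod.subspace_0[OF Rsub(1)] by blast
  then have "zspan (R \<union> zspan ?T) = zmod.span R" by (simp only: T, simp only: zspan_eq)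
  with eq have "K = zmod.span R" by (rule trans)
  also have "\<dots> = R" using Rsub(1) by (rule zmod.span_eq_iff[THEN iffD2])
  finally show ?thesis .
qed

text \<open>\<open>C\<close> is an arbitrary splitting, so \<open>R\<close> occurs in every one.
  This allows two frames to be compared within a single splitting.\<close>

lemma R_component: "R \<in> C"
proof -
  have "f 1 \<noteq> f 2" using frame_inner[of 1 2] frame_inner[of 1 1] index_mem by auto
  then obtain K where "K \<in> C" "f 1 - f 2 \<in> K"
    using root_in_component H_diff H_diff_root frame_in_H index_mem by metis
  then show ?thesis using component_eq_R by blast
qed

end

lemma R_indecomposable_component: "indecomposable_component (root_sublattice L) R"
  using indecomposable_splitting_exists[OF root_sublattice_lattice] R_component
  by (auto simp: indecomposable_component_def)

text \<open>Supplies the uniqueness behind \<open>THE\<close> without a general uniqueness theorem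
  for splittings: a component containing \<open>f 1 - f 2\<close> can only be
  \<open>R\<close>.\<close>

lemma root_component_eq_R:
  assumes "N \<subseteq> R" "f 1 - f 2 \<in> N"
  shows "root_component L N = R"
  unfolding root_component_def
proof (rule the_equality)
  show "indecomposable_component (root_sublattice L) R \<and> N \<subseteq> R"
    using R_indecomposable_component assms by simp
next
  fix K assume "indecomposable_component (root_sublattice L) K \<and> N \<subseteq> K"
  then show "K = R"
    using component_eq_R assms(2) unfolding indecomposable_component_def by blast
qed

end

section \<open>Two frames\<close>

text \<open>Two distinct differences \<open>g 1 - g i\<close>, \<open>g 1 - g j\<close> have inner
  product 1, so their expressions in \<open>A\<close> share exactly one of the first and second
  terms. The shared side is the same for all indices; \<open>c\<close> is 1 if it is the first and
  -1 if it is the second.\<close>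

lemma difference_star:
  fixes g :: "nat \<Rightarrow> 'a::real_inner"
  assumes n: "3 \<le> n"
    and g: "orthonormal_family n g"
    and A: "\<And>x y. x \<in> A \<Longrightarrow> y \<in> A \<Longrightarrow> x \<bullet> y = (if x = y then 1 else 0)"
    and diff: "\<And>j. j \<in> {2..n} \<Longrightarrow> \<exists>a\<in>A. \<exists>b\<in>A. a \<noteq> b \<and> g 1 - g j = a - b"
  shows "\<exists>c x b. (c = 1 \<or> c = (-1::real)) \<and> b ` {1..n} \<subseteq> A \<and> (\<forall>j\<in>{1..n}. g j = x + c *\<^sub>R b j)"
proof -
  obtain a b where ab: "\<And>j. j \<in> {2..n} \<Longrightarrow> a j \<in> A \<and> b j \<in> A \<and> a j \<noteq> b j \<and> g 1 - g j = a j - b j"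
    using diff by metis
  have gi: "g i \<bullet> g j = (if i = j then 1 else 0)" if "i \<in> {1..n}" "j \<in> {1..n}" for i j
    using g that by (simp add: orthonormal_family_def)
  have pair: "(a i = a j) \<noteq> (b i = b j)" if ij: "i \<in> {2..n}" "j \<in> {2..n}" "i \<noteq> j" for i j
  proof -
    have "(g 1 - g i) \<bullet> (g 1 - g j) = 1" using ij n by (simp add: inner_diff gi)
    then have "(a i - b i) \<bullet> (a j - b j) = 1" using ab ij by metis
    then have "a i = a j \<or> b i = b j"
      using ab[OF ij(1)] ab[OF ij(2)] by (auto simp: inner_diff A split: if_splits)
    moreover have "g i \<noteq> g j" using gi[of i i] gi[of i j] ij by auto
    then have "g 1 - g i \<noteq> g 1 - g j" by simp
    then have "\<not> (a i = a j \<and> b i = b j)" using ab[OF ij(1)] ab[OF ij(2)] by metis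
    ultimately show ?thesis by blast
  qed
  have idx: "2 \<in> {2..n}" "3 \<in> {2..n}" "2 \<noteq> (3::nat)" using n by auto
  show ?thesis
  proof (cases "a 2 = a 3")
    case True
    \<comment> \<open>If \<open>a j\<close> differed from \<open>a 2 = a 3\<close>, then
      \<open>b j\<close> would equal both \<open>b 2\<close> and \<open>b 3\<close>, which are
      distinct.\<close>
    have a: "a j = a 2" if "j \<in> {2..n}" for j
      using pair[OF idx] pair[OF idx(1) that] pair[OF idx(2) that] True by (cases "j = 2 \<or> j = 3") metis+
    show ?thesis
    \<comment> \<open>Index 1 is outside the range of \<open>diff\<close>; the shared term
      \<open>a 2\<close> is the value that fits the formula there.\<close>
    proof (intro exI[of _ 1] exI[of _ "g 1 - a 2"] exI[of _ "b(1 := a 2)"] conjI ballI)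
      show "(b(1 := a 2)) ` {1..n} \<subseteq> A" using ab idx(1) by auto
      fix j assume jn: "j \<in> {1..n}"
      show "g j = g 1 - a 2 + 1 *\<^sub>R (b(1 := a 2)) j"
      proof (cases "j = 1")
        case False
        then have j: "j \<in> {2..n}" using jn by auto
        then have "g 1 - g j = a 2 - b j" using ab a by metis
        then show ?thesis using False by (simp add: algebra_simps)
      qed simp
    qed simp
  next
    case False
    have b: "b j = b 2" if "j \<in> {2..n}" for j
      using pair[OF idx] pair[OF idx(1) that] pair[OF idx(2) that] False by (cases "j = 2 \<or> j = 3") metis+
    show ?thesis
    proof (intro exI[of _ "-1"] exI[of _ "g 1 + b 2"] exI[of _ "a(1 := b 2)"] conjI ballI)
      show "(a(1 := b 2)) ` {1..n} \<subseteq> A" using ab idx(1) by auto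
      fix j assume jn: "j \<in> {1..n}"
      show "g j = g 1 + b 2 + (-1) *\<^sub>R (a(1 := b 2)) j"
      proof (cases "j = 1")
        case False
        then have j: "j \<in> {2..n}" using jn by auto
        then have "g 1 - g j = a j - b 2" using ab b by metis
        then show ?thesis using False by (simp add: algebra_simps)
      qed simp
    qed simp
  qed
qed

lemma root_frame_R_distinct:
  assumes F: "root_frame L f n k" and G: "root_frame L g n s"
    and cop: "coprime s k" and ks: "2 * k * s < n"
  shows "root_frame.R L f \<noteq> root_frame.R L g"
proof
  interpret F: root_frame L f n k by (rule F)
  interpret G: root_frame L g n s by (rule G)
  assume R: "F.R = G.R"
  have diff: "\<exists>a\<in>F.H. \<exists>b\<in>F.H. a \<noteq> b \<and> g 1 - g j = a - b" if "j \<in> {2..n}" for j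
  proof (rule F.root_in_R)
    have j: "j \<in> {1..n}" "j \<noteq> 1" using that by auto
    show "g 1 - g j \<in> F.R"
      unfolding R by (intro G.H_diff_in_R G.frame_in_H G.index_mem j)
    show "(g 1 - g j) \<bullet> (g 1 - g j) = 2"
      using j G.index_mem by (simp add: inner_diff G.frame_inner)
  qed
  obtain c x b where c: "c = 1 \<or> c = (-1::real)" and b: "b ` {1..n} \<subseteq> F.H"
    and gb: "\<And>j. j \<in> {1..n} \<Longrightarrow> g j = x + c *\<^sub>R b j"
    using difference_star[OF F.n_ge_3 G.frame F.H_inner diff] by blast
  have cc: "c * c = 1" using c by auto
  have bi: "b i \<bullet> b j = (if i = j then 1 else 0)" if ij: "i \<in> {1..n}" "j \<in> {1..n}" for i j
  proof -
    have "g i \<noteq> g j" if "i \<noteq> j" using G.frame_inner[of i i] G.frame_inner[of i j] ij that by auto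
    then have "b i = b j \<longleftrightarrow> i = j" using gb ij by metis
    then show ?thesis using F.H_inner[of "b i" "b j"] b ij by (simp add: image_subset_iff)
  qed
  define t where "t = x \<bullet> x"
  \<comment> \<open>Compare the norms in \<open>g j = x + c b j\<close>, where \<open>g j\<close>
    and \<open>b j\<close> are unit vectors.\<close>
  have xb: "x \<bullet> b j = - c * t / 2" if j: "j \<in> {1..n}" for j
  proof -
    have "1 = (x + c *\<^sub>R b j) \<bullet> (x + c *\<^sub>R b j)" using G.frame_inner[OF j j] gb[OF j] by simp
    also have "\<dots> = t + 2 * c * (x \<bullet> b j) + c * c"
      using bi[OF j j] by (simp add: inner_add inner_commute t_def algebra_simps)
    finally have "2 * c * (x \<bullet> b j) = - t" using cc by simp
    then show ?thesis using c by auto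
  qed
  have "orthonormal_family n b" using bi by (simp add: orthonormal_family_def)
  then have "(\<Sum>i=1..n. (x \<bullet> b i)\<^sup>2) \<le> t" unfolding t_def by (rule orthonormal_bessel)
  moreover have "(\<Sum>i=1..n. (x \<bullet> b i)\<^sup>2) = (\<Sum>i=1..n. t\<^sup>2 / 4)"
    using c by (intro sum.cong refl) (auto simp: xb power2_eq_square)
  ultimately have bessel: "real n * t * t \<le> 4 * t" by (simp add: power2_eq_square)
  have "t = 0"
  proof (rule ccontr)
    assume "t \<noteq> 0"
    then have t: "t > 0" by (simp add: t_def)
    then have nt: "real n * t \<le> 4" using bessel by simp
    have pos: "real k * real s > 0" using F.odd G.odd by (cases k; cases s) auto
    \<comment> \<open>With the different indices 1 and 2, the term in
      \<open>b 1 \<bullet> b 2\<close> drops out and only the contribution of \<open>x\<close>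
      remains.\<close>
    have "(of_nat k *\<^sub>R b 1) \<bullet> (of_nat s *\<^sub>R g 2) \<in> \<int>"
      using F.inner_Ints F.H_scale G.frame_scale b F.index_mem by blast
    moreover have "(of_nat k *\<^sub>R b 1) \<bullet> (of_nat s *\<^sub>R g 2) = - c * (real k * real s * t / 2)"
      using F.index_mem gb[of 2] bi[of 1 2] xb[of 1] by (simp add: inner_add_right inner_commute)
    ultimately have "c * (real k * real s * t / 2) \<in> \<int>" by simp
    then have "real k * real s * t / 2 \<in> \<int>" using c by auto
    then obtain z where z: "real k * real s * t / 2 = of_int z" by (rule Ints_cases)
    \<comment> \<open>Together with \<open>n t \<le> 4\<close> this puts the positive integer
      \<open>k s t / 2\<close> below 1.\<close>
    have "2 * (real k * real s) < real n"
      using ks by (metis mult.assoc of_nat_less_iff of_nat_mult of_nat_numeral)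
    then have "2 * (real k * real s) * t < real n * t" using t by (rule mult_strict_right_mono)
    then have "real_of_int z < 1" using z nt by simp
    moreover have "real_of_int z > 0" using z mult_pos_pos[OF pos t] by linarith
    ultimately show False by simp
  qed
  then have "g 1 = c *\<^sub>R b 1" using gb[OF F.index_mem(1)] by (simp add: t_def)
  then have "of_nat s *\<^sub>R (c *\<^sub>R b 1) \<in> L" using G.frame_scale[OF F.index_mem(1)] by simp
  then have "of_nat s *\<^sub>R b 1 \<in> L" using c F.neg_mem by fastforce
  moreover have b1: "b 1 \<in> F.H" using b F.index_mem by blast
  ultimately have "b 1 \<in> L" using coprime_scale_mem[OF F.subspace cop] F.H_scale by blast
  then show False using F.H_not_in_L b1 by blast
qed

section \<open>Frames from representations\<close>

lemma A_root_subset: "A_root n e \<subseteq> A_lat n k e"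
  unfolding A_root_def A_lat_def zspan_eq by (rule zmod.span_mono) blast

lemma A_lat_subspace: "zmod.subspace (A_lat n k e)"
  by (simp add: A_lat_def zspan_eq)

lemma A_root_subspace: "zmod.subspace (A_root n e)"
  by (simp add: A_root_def zspan_eq)

lemma A_root_diff:
  assumes "i \<in> {1..n}" "j \<in> {1..n}"
  shows "e i - e j \<in> A_root n e"
proof -
  \<comment> \<open>Telescoping from index 1.\<close>
  have *: "m \<le> n \<longrightarrow> e m - e 1 \<in> A_root n e" if "1 \<le> m" for m
    using that
  proof (induction m rule: dec_induct)
    case base
    show ?case by (simp add: zmod.subspace_0[OF A_root_subspace])
  next
    case (step m)
    show ?case
    proof
      assume "Suc m \<le> n"
      then have "- e m + e (m + 1) \<in> A_root n e"
        unfolding A_root_def zspan_eq using step.hyps by (intro zmod.span_base) auto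
      moreover have "e m - e 1 \<in> A_root n e" using step \<open>Suc m \<le> n\<close> by simp
      ultimately have "(- e m + e (m + 1)) + (e m - e 1) \<in> A_root n e"
        using zmod.subspace_add[OF A_root_subspace] by blast
      then show "e (Suc m) - e 1 \<in> A_root n e" by (simp add: Suc_eq_plus1 del: add_Suc_right)
    qed
  qed
  have "(e i - e 1) - (e j - e 1) \<in> A_root n e"
    by (rule zmod.subspace_diff[OF A_root_subspace]) (use assms * in auto)
  then show ?thesis by simp
qed

text \<open>\<open>k e i\<close> is the sum of the \<open>k\<close> differences
  \<open>e i - e j\<close> over the last \<open>k\<close> indices, minus the extra
  generator.\<close>

lemma A_lat_scale:
  assumes "i \<in> {1..n}" "k \<le> n"
  shows "of_nat k *\<^sub>R e i \<in> A_lat n k e"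
proof -
  let ?J = "{n - k + 1..n}"
  have "- (\<Sum>j\<in>?J. e j) \<in> A_lat n k e"
    unfolding A_lat_def zspan_eq by (intro zmod.span_base) simp
  moreover have "(\<Sum>j\<in>?J. e i - e j) \<in> A_lat n k e"
    using assms by (intro zmod.subspace_sum A_lat_subspace A_root_diff A_root_subset[THEN subsetD]) auto
  ultimately have "(\<Sum>j\<in>?J. e i - e j) - - (\<Sum>j\<in>?J. e j) \<in> A_lat n k e"
    using zmod.subspace_diff[OF A_lat_subspace] by blast
  moreover have "card ?J = k" using assms by simp
  ultimately show ?thesis by (simp add: sum_subtractf sum_constant_scaleR)
qed

text \<open>\<open>\<phi>\<close> is only controlled on \<open>A_lat n k e\<close>, which contains \<open>k e\<^sub>i\<close> but not \<open>e\<^sub>i\<close>.\<close>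

definition rep_frame :: "nat \<Rightarrow> (nat \<Rightarrow> 'b::real_inner) \<Rightarrow> ('b \<Rightarrow> 'a::real_inner) \<Rightarrow> nat \<Rightarrow> 'a" where
  "rep_frame k e \<phi> i = (1 / real k) *\<^sub>R \<phi> (of_nat k *\<^sub>R e i)"

context
  fixes n k :: nat and e :: "nat \<Rightarrow> 'b::real_inner" and L :: "'a::euclidean_space set"
    and \<phi> :: "'b \<Rightarrow> 'a"
  assumes on: "orthonormal_family n e"
    and lat: "zlattice L" and min: "lattice_min L \<ge> 2"
    and rep: "representation (A_lat n k e) L \<phi>"
    and odd: "odd k" and bound: "2 * k\<^sup>2 < n"
begin

lemma rep_lin:
  "x \<in> A_lat n k e \<Longrightarrow> y \<in> A_lat n k e \<Longrightarrow>
    \<phi> (of_int a *\<^sub>R x + of_int b *\<^sub>R y) = of_int a *\<^sub>R \<phi> x + of_int b *\<^sub>R \<phi> y"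
  using rep by (simp add: representation_def)

text \<open>Polarization.\<close>

lemma rep_inner:
  assumes "x \<in> A_lat n k e" "y \<in> A_lat n k e"
  shows "\<phi> x \<bullet> \<phi> y = x \<bullet> y"
proof -
  have q: "\<phi> z \<bullet> \<phi> z = z \<bullet> z" if "z \<in> A_lat n k e" for z
    using rep that by (simp add: representation_def)
  have "\<phi> (x + y) = \<phi> x + \<phi> y" using rep_lin[OF assms, of 1 1] by simp
  then show ?thesis
    using q[OF assms(1)] q[OF assms(2)] q[OF zmod.subspace_add[OF A_lat_subspace assms]]
    by (simp add: inner_add inner_commute)
qed

lemma k_bounds: "0 < k" "k \<le> n"
proof -
  show "0 < k" using odd by (cases k) auto
  have "k \<le> k\<^sup>2" by (simp add: power2_eq_square)
  then show "k \<le> n" using bound by linarith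
qed

text \<open>\<open>e i - e j\<close> itself lies in the lattice, so the factor \<open>k\<close> can
  be pulled out of \<phi> and cancels.\<close>

lemma rep_frame_diff:
  assumes "i \<in> {1..n}" "j \<in> {1..n}"
  shows "rep_frame k e \<phi> i - rep_frame k e \<phi> j = \<phi> (e i - e j)"
proof -
  note sc = A_lat_scale[OF _ k_bounds(2), of _ e]
  have d: "e i - e j \<in> A_lat n k e" using A_root_diff[OF assms] A_root_subset by blast
  have "\<phi> (of_nat k *\<^sub>R e i) - \<phi> (of_nat k *\<^sub>R e j) = \<phi> (of_nat k *\<^sub>R e i - of_nat k *\<^sub>R e j)"
    using rep_lin[OF sc[OF assms(1)] sc[OF assms(2)], of 1 "-1"] by simp
  also have "\<dots> = of_nat k *\<^sub>R \<phi> (e i - e j)"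
    using rep_lin[OF d d, of "int k" 0] by (simp add: scaleR_diff_right)
  finally have "rep_frame k e \<phi> i - rep_frame k e \<phi> j = (1 / real k) *\<^sub>R (of_nat k *\<^sub>R \<phi> (e i - e j))"
    unfolding rep_frame_def by (simp flip: scaleR_diff_right)
  then show ?thesis using k_bounds by simp
qed

lemma root_frame_rep: "root_frame L (rep_frame k e \<phi>) n k"
proof
  have inL: "\<phi> x \<in> L" if "x \<in> A_lat n k e" for x
    using rep that by (simp add: representation_def)
  note sc = A_lat_scale[OF _ k_bounds(2), of _ e]
  show "zlattice L" "odd k" "2 * k\<^sup>2 < n" by (rule lat odd bound)+
  show "2 \<le> x \<bullet> x" if "x \<in> L" "x \<noteq> 0" for x
    using lattice_min_le[OF lat that] min by linarith
  show "orthonormal_family n (rep_frame k e \<phi>)"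
    unfolding orthonormal_family_def
  proof (intro ballI)
    fix i j assume ij: "i \<in> {1..n}" "j \<in> {1..n}"
    then have "e i \<bullet> e j = (if i = j then 1 else 0)" using on by (simp add: orthonormal_family_def)
    then show "rep_frame k e \<phi> i \<bullet> rep_frame k e \<phi> j = (if i = j then 1 else 0)"
      using k_bounds(1) by (simp add: rep_frame_def rep_inner[OF sc[OF ij(1)] sc[OF ij(2)]])
  qed
  show "rep_frame k e \<phi> i - rep_frame k e \<phi> j \<in> L" if "i \<in> {1..n}" "j \<in> {1..n}" for i j
    unfolding rep_frame_diff[OF that]
    using A_root_diff[OF that] A_root_subset by (intro inL) blast
  show "of_nat k *\<^sub>R rep_frame k e \<phi> i \<in> L" if "i \<in> {1..n}" for i
    using inL[OF sc[OF that]] k_bounds(1) by (simp add: rep_frame_def)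
qed

lemma rep_root_component:
  "root_component L (\<phi> ` A_root n e) = root_frame.R L (rep_frame k e \<phi>)"
proof -
  interpret root_frame L "rep_frame k e \<phi>" n k by (rule root_frame_rep)
  have Rsub: "zmod.subspace R" by (simp add: R_def zspan_eq)
  \<comment> \<open>Membership is carried through the induction because \<phi> is known to be linear
    only on the lattice.\<close>
  have "x \<in> A_root n e \<and> \<phi> x \<in> R" if "x \<in> A_root n e" for x
    using that unfolding A_root_def
  proof (induction rule: zspan_induct)
    case base
    have "\<phi> 0 = 0"
      using rep_lin[of 0 0 0 0] by (simp add: zmod.subspace_0[OF A_lat_subspace])
    then show ?case
      using zmod.subspace_0[OF Rsub] by (simp add: zspan_eq zmod.span_zero)
  next
    case (step a x y)
    then obtain i where i: "i \<in> {1..<n}" "x = - e i + e (i + 1)" by blast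
    then have i': "i + 1 \<in> {1..n}" "i \<in> {1..n}" and x: "x = e (i + 1) - e i" by auto
    have xA: "x \<in> A_root n e" unfolding x by (rule A_root_diff[OF i'])
    have yA: "y \<in> A_root n e" and yR: "\<phi> y \<in> R" using step by (auto simp: A_root_def)
    have "\<phi> x \<in> R"
      unfolding x rep_frame_diff[OF i', symmetric] by (intro H_diff_in_R frame_in_H i')
    moreover have "\<phi> (of_int a *\<^sub>R x + y) = of_int a *\<^sub>R \<phi> x + \<phi> y"
      using rep_lin[of x y a 1] xA yA A_root_subset by fastforce
    ultimately have "\<phi> (of_int a *\<^sub>R x + y) \<in> R"
      using zmod.subspace_add[OF Rsub zmod.subspace_scale[OF Rsub]] yR by metis
    moreover have "of_int a *\<^sub>R x + y \<in> A_root n e"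
      by (intro zmod.subspace_add zmod.subspace_scale A_root_subspace xA yA)
    ultimately show ?case by (simp add: A_root_def)
  qed
  then have "\<phi> ` A_root n e \<subseteq> R" by blast
  moreover have "rep_frame k e \<phi> 1 - rep_frame k e \<phi> 2 \<in> \<phi> ` A_root n e"
    unfolding rep_frame_diff[OF index_mem] by (intro imageI A_root_diff index_mem)
  ultimately show ?thesis by (rule root_component_eq_R)
qed

end

theorem theorem4p5:
  fixes n s k :: nat
    and e :: "nat \<Rightarrow> 'b::euclidean_space"
    and L :: "'a::euclidean_space set"
    and \<phi>\<^sub>k \<phi>\<^sub>s :: "'b \<Rightarrow> 'a"
  assumes "coprime s k" and "odd s" and "odd k"
    and "1 < s" and "s < k" and "real k < sqrt (real n / 2)"
    and "orthonormal_family n e"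
    and "zlattice L" and "lattice_min L \<ge> 2"
    and "representation (A_lat n k e) L \<phi>\<^sub>k"
    and "representation (A_lat n s e) L \<phi>\<^sub>s"
  shows "indecomposable_component (root_sublattice L) (root_component L (\<phi>\<^sub>k ` A_root n e)) \<and>
         indecomposable_component (root_sublattice L) (root_component L (\<phi>\<^sub>s ` A_root n e)) \<and>
         root_component L (\<phi>\<^sub>k ` A_root n e) \<noteq> root_component L (\<phi>\<^sub>s ` A_root n e) \<and>
         orthogonal_lattices (root_component L (\<phi>\<^sub>k ` A_root n e))
                             (root_component L (\<phi>\<^sub>s ` A_root n e))"
proof -
  have "(real k)\<^sup>2 < real n / 2"
    using power_strict_mono[OF assms(6), of 2] by simp
  then have "real (2 * k\<^sup>2) < real n" by simp
  then have bk: "2 * k\<^sup>2 < n" by (simp only: of_nat_less_iff)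
  have "s\<^sup>2 \<le> k\<^sup>2" "k * s \<le> k\<^sup>2" using assms(5) by (simp_all add: power2_eq_square mult_le_mono)
  then have bs: "2 * s\<^sup>2 < n" and bks: "2 * k * s < n" using bk by linarith+
  let ?f = "rep_frame k e \<phi>\<^sub>k" and ?g = "rep_frame s e \<phi>\<^sub>s"
  have F: "root_frame L ?f n k" and eqF: "root_component L (\<phi>\<^sub>k ` A_root n e) = root_frame.R L ?f"
    using root_frame_rep rep_root_component assms bk by blast+
  have G: "root_frame L ?g n s" and eqG: "root_component L (\<phi>\<^sub>s ` A_root n e) = root_frame.R L ?g"
    using root_frame_rep rep_root_component assms bs by blast+
  have ne: "root_frame.R L ?f \<noteq> root_frame.R L ?g"
    by (rule root_frame_R_distinct[OF F G assms(1) bks])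
  \<comment> \<open>One splitting contains both components, so being distinct makes them
    orthogonal.\<close>
  obtain C where C: "indecomposable_splitting (root_sublattice L) C"
    using indecomposable_splitting_exists root_frame.root_sublattice_lattice[OF F] by blast
  have "orthogonal_lattices (root_frame.R L ?f) (root_frame.R L ?g)"
    using C root_frame.R_component[OF F C] root_frame.R_component[OF G C] ne
    by (auto simp: indecomposable_splitting_def pairwise_def)
  then show ?thesis
    unfolding eqF eqG
    using ne root_frame.R_indecomposable_component[OF F] root_frame.R_indecomposable_component[OF G]
    by blast
qed

end
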